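(* Let $P$ be an augmented program and $M$ a set of atoms. Then $M$ is an answer set of $P$ if and only if $P\cup\neg\overline{M}\cup\neg\neg M\ \vdash^{c}_{I}\ M$, i.e. the theory $P\cup\neg\overline{M}\cup\neg\neg M$ is consistent in intuitionistic logic and intuitionistically proves every atom of $M$.
   Context: Formulas are propositional formulas over atoms with $\land,\lor,\leftarrow$ (implication; $H\leftarrow B$ means "$B$ implies $H$") and $\bot$; $\neg F$ abbreviates $\bot\leftarrow F$, $\top$ abbreviates $\bot\leftarrow\bot$. $\sigma_P$ is the set of atoms occurring in $P$. A nested formula is built from atoms, $\bot,\top$ using $\land,\lor,\neg$ arbitrarily nested; an augmented program is a finite set of clauses $H\leftarrow B$ with $H,B$ nested formulas. Answer sets: elementary formulas are atoms, $\bot,\top$; basic formulas are built from them with $\land,\lor$. For a set of atoms $X$: $X\models F$ for elementary $F$ iff $F\in X$ or $F=\top$; $X\models F\land G$ iff $X\models F$ and $X\models G$; $X\models F\lor G$ iff $X\models F$ or $X\models G$. $X$ is closed under a basic program $Q$ if for each $H\leftarrow B\in Q$, $X\models B$ implies $X\models H$; $X$ is an answer set of basic $Q$ if it is $\subseteq$-minimal among sets closed under $Q$. Reduct: $F^X=F$ for elementary $F$; $(F\land G)^X=F^X\land G^X$; $(F\lor G)^X=F^X\lor G^X$; $(\neg F)^X=\bot$ if $X\models F^X$, else $\top$; $(H\leftarrow B)^X=H^X\leftarrow B^X$; $P^X=\{C^X:C\in P\}$. $X$ is an answer set of augmented $P$ iff $X$ is an answer set of $P^X$. Notation: $\overline{M}=\sigma_P\setminus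 M$; for a set $S$ of atoms, $\neg S=\{\neg a: a\in S\}$ and $\neg\neg S=\{\neg\neg a:a\in S\}$. For a theory $T$, $T\vdash_I F$ means $(F_1\land\dots\land F_n)\to F$ is an intuitionistic theorem for some $F_1,\dots,F_n\in T$; $T\vdash_I U$ means $T\vdash_I F$ for all $F\in U$; $T$ is consistent if not $T\vdash_I\bot$; $T\vdash^c_I U$ means $T$ is consistent and $T\vdash_I U$. *)

theory Defs
  imports Main
begin

datatype (atoms: 'a) form =
    Atom 'a
  | Bot  (\<open>\<^bold>\<bottom>\<close>)
  | And "'a form" "'a form"  (infixr \<open>\<^bold>\<and>\<close> 75)
  | Or "'a form" "'a form"  (infixr \<open>\<^bold>\<or>\<close> 70)
  | Impl "'a form" "'a form"  (infixl \<open>\<^bold>\<leftarrow>\<close> 65)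
  \<comment> \<open>head first: \<open>H \<^bold>\<leftarrow> B\<close> says that \<open>B\<close> implies \<open>H\<close>\<close>

abbreviation (input) Impl_right :: "'a form \<Rightarrow> 'a form \<Rightarrow> 'a form"  (infixr \<open>\<^bold>\<rightarrow>\<close> 65)
  where "F \<^bold>\<rightarrow> G \<equiv> G \<^bold>\<leftarrow> F"

abbreviation Neg :: "'a form \<Rightarrow> 'a form"  (\<open>\<^bold>\<not> _\<close> [80] 80)
  where "\<^bold>\<not> F \<equiv> \<^bold>\<bottom> \<^bold>\<leftarrow> F"

abbreviation Top :: "'a form"  (\<open>\<^bold>\<top>\<close>)
  where "\<^bold>\<top> \<equiv> \<^bold>\<bottom> \<^bold>\<leftarrow> \<^bold>\<bottom>"

definition sig :: "'a form set \<Rightarrow> 'a set"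
  where "sig P = (\<Union>F\<in>P. atoms F)"


subsection \<open>Augmented programs and answer sets\<close>

inductive basic_formula :: "'a form \<Rightarrow> bool" where
  "basic_formula (Atom a)"
| "basic_formula \<^bold>\<bottom>"
| "basic_formula \<^bold>\<top>"
| "basic_formula F \<Longrightarrow> basic_formula G \<Longrightarrow> basic_formula (F \<^bold>\<and> G)"
| "basic_formula F \<Longrightarrow> basic_formula G \<Longrightarrow> basic_formula (F \<^bold>\<or> G)"

inductive nested_formula :: "'a form \<Rightarrow> bool" where
  "nested_formula (Atom a)"
| "nested_formula \<^bold>\<bottom>"
| "nested_formula \<^bold>\<top>"
| "nested_formula F \<Longrightarrow> nested_formula G \<Longrightarrow> nested_formula (F \<^bold>\<and> G)"
| "nested_formula F \<Longrightarrow> nested_formula G \<Longrightarrow> nested_formula (F \<^bold>\<or> G)"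
| "nested_formula F \<Longrightarrow> nested_formula (\<^bold>\<not> F)"

definition augmented_program :: "'a form set \<Rightarrow> bool"
  where "augmented_program P \<longleftrightarrow>
    finite P \<and> (\<forall>C\<in>P. \<exists>H B. C = (H \<^bold>\<leftarrow> B) \<and> nested_formula H \<and> nested_formula B)"

text \<open>Only the values at basic formulas matter; the only implication among these is \<open>\<^bold>\<top>\<close>.\<close>

primrec sat :: "'a set \<Rightarrow> 'a form \<Rightarrow> bool"  (infix \<open>\<Turnstile>\<close> 50) where
  "X \<Turnstile> Atom a \<longleftrightarrow> a \<in> X"
| "X \<Turnstile> \<^bold>\<bottom> \<longleftrightarrow> False"
| "X \<Turnstile> (F \<^bold>\<and> G) \<longleftrightarrow> X \<Turnstile> F \<and> X \<Turnstile> G"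
| "X \<Turnstile> (F \<^bold>\<or> G) \<longleftrightarrow> X \<Turnstile> F \<or> X \<Turnstile> G"
| "X \<Turnstile> (H \<^bold>\<leftarrow> B) \<longleftrightarrow> (H \<^bold>\<leftarrow> B) = \<^bold>\<top>"

definition closed_under :: "'a set \<Rightarrow> 'a form set \<Rightarrow> bool"
  where "closed_under X Q \<longleftrightarrow> (\<forall>H B. (H \<^bold>\<leftarrow> B) \<in> Q \<longrightarrow> X \<Turnstile> B \<longrightarrow> X \<Turnstile> H)"

definition basic_answer_set :: "'a set \<Rightarrow> 'a form set \<Rightarrow> bool"
  where "basic_answer_set X Q \<longleftrightarrow>
    closed_under X Q \<and> (\<forall>Y. closed_under Y Q \<and> Y \<subseteq> X \<longrightarrow> Y = X)"

text \<open>
  Only the values at nested formulas matter; the only implications among these are negations,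
  the elementary formula \<open>\<^bold>\<top> = \<^bold>\<not> \<^bold>\<bottom>\<close> included, which is its own reduct. Clauses are treated
  separately below, because a constraint \<open>\<^bold>\<bottom> \<^bold>\<leftarrow> B\<close> and the negation \<open>\<^bold>\<not> B\<close> are the same formula
  but have different reducts.
\<close>

primrec reduct :: "'a set \<Rightarrow> 'a form \<Rightarrow> 'a form" where
  "reduct X (Atom a) = Atom a"
| "reduct X \<^bold>\<bottom> = \<^bold>\<bottom>"
| "reduct X (F \<^bold>\<and> G) = (reduct X F \<^bold>\<and> reduct X G)"
| "reduct X (F \<^bold>\<or> G) = (reduct X F \<^bold>\<or> reduct X G)"
| "reduct X (H \<^bold>\<leftarrow> B) =
    (if H = \<^bold>\<bottom> then (if X \<Turnstile> reduct X B then \<^bold>\<bottom> else \<^bold>\<top>) else (H \<^bold>\<leftarrow> B))"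

definition reduct_program :: "'a form set \<Rightarrow> 'a set \<Rightarrow> 'a form set"
  where "reduct_program P X = {reduct X H \<^bold>\<leftarrow> reduct X B |H B. (H \<^bold>\<leftarrow> B) \<in> P}"

lemma reduct_Top: "reduct X \<^bold>\<top> = \<^bold>\<top>"
  by simp

lemma basic_formula_reduct: "nested_formula F \<Longrightarrow> basic_formula (reduct X F)"
  by (induction rule: nested_formula.induct) (auto intro: basic_formula.intros)

definition answer_set :: "'a set \<Rightarrow> 'a form set \<Rightarrow> bool"
  where "answer_set X P \<longleftrightarrow> basic_answer_set X (reduct_program P X)"


subsection \<open>Intuitionistic propositional logic\<close>

inductive int_theorem :: "'a form \<Rightarrow> bool" where
  K: "int_theorem (F \<^bold>\<rightarrow> G \<^bold>\<rightarrow> F)"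
| S: "int_theorem ((F \<^bold>\<rightarrow> G \<^bold>\<rightarrow> H) \<^bold>\<rightarrow> (F \<^bold>\<rightarrow> G) \<^bold>\<rightarrow> F \<^bold>\<rightarrow> H)"
| AndI: "int_theorem (F \<^bold>\<rightarrow> G \<^bold>\<rightarrow> F \<^bold>\<and> G)"
| AndE1: "int_theorem (F \<^bold>\<and> G \<^bold>\<rightarrow> F)"
| AndE2: "int_theorem (F \<^bold>\<and> G \<^bold>\<rightarrow> G)"
| OrI1: "int_theorem (F \<^bold>\<rightarrow> F \<^bold>\<or> G)"
| OrI2: "int_theorem (G \<^bold>\<rightarrow> F \<^bold>\<or> G)"
| OrE: "int_theorem ((F \<^bold>\<rightarrow> H) \<^bold>\<rightarrow> (G \<^bold>\<rightarrow> H) \<^bold>\<rightarrow> F \<^bold>\<or> G \<^bold>\<rightarrow> H)"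
| BotE: "int_theorem (\<^bold>\<bottom> \<^bold>\<rightarrow> F)"
| MP: "int_theorem (F \<^bold>\<rightarrow> G) \<Longrightarrow> int_theorem F \<Longrightarrow> int_theorem G"

fun conj :: "'a form list \<Rightarrow> 'a form" where
  "conj [] = \<^bold>\<top>"
| "conj [F] = F"
| "conj (F # Fs) = (F \<^bold>\<and> conj Fs)"

definition derives :: "'a form set \<Rightarrow> 'a form \<Rightarrow> bool"  (infix \<open>\<turnstile>\<^sub>I\<close> 50)
  where "T \<turnstile>\<^sub>I F \<longleftrightarrow> (\<exists>Fs. set Fs \<subseteq> T \<and> int_theorem (conj Fs \<^bold>\<rightarrow> F))"

definition consistent :: "'a form set \<Rightarrow> bool"
  where "consistent T \<longleftrightarrow> \<not> T \<turnstile>\<^sub>I \<^bold>\<bottom>"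

definition derives_consistently :: "'a form set \<Rightarrow> 'a form set \<Rightarrow> bool"  (infix \<open>\<turnstile>\<^sup>c\<^sub>I\<close> 50)
  where "T \<turnstile>\<^sup>c\<^sub>I U \<longleftrightarrow> consistent T \<and> (\<forall>F\<in>U. T \<turnstile>\<^sub>I F)"

end

theory Submission
  imports Defs
begin

text \<open>
  Both sides are compared with models \<open>(Y, X)\<close>, \<open>Y \<subseteq> X\<close>, of the logic of here-and-there (Kripke
  models with two worlds): on nested formulas, \<open>Y\<close> satisfies the reduct relative to \<open>X\<close> iff
  \<open>(Y, X)\<close> is a here-and-there model. Soundness of intuitionistic logic then gives minimality of
  \<open>M\<close> from provability of its atoms. Conversely, the theory \<open>T\<close> decides each formula up to double
  negation, and \<open>T \<union> Y\<close> proves every atom of \<open>M\<close> for all \<open>Y \<subseteq> M\<close>, by induction on the size of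
  \<open>M - Y\<close>: if \<open>Y \<noteq> M\<close>, some clause \<open>H \<^bold>\<leftarrow> B\<close> fails at \<open>(Y, M)\<close>; then \<open>T \<union> Y\<close> proves \<open>H\<close>, and a case
  distinction along \<open>H\<close> adds an atom to \<open>Y\<close> or is contradictory.
\<close>

subsection \<open>Intuitionistic derivations from a set of assumptions\<close>

text \<open>The relation \<open>\<turnstile>\<^sub>I\<close> refers to the conjunction of a list of
  premises. An inductive relation gives rule induction and the deduction theorem instead;
  \<open>derives_iff_ded\<close> shows that the two agree.\<close>

inductive ded :: "'a form set \<Rightarrow> 'a form \<Rightarrow> bool"  (infix \<open>\<turnstile>\<close> 50) for T where
  taut: "int_theorem F \<Longrightarrow> T \<turnstile> F"
| assm: "F \<in> T \<Longrightarrow> T \<turnstile> F"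
| mp: "T \<turnstile> F \<^bold>\<rightarrow> G \<Longrightarrow> T \<turnstile> F \<Longrightarrow> T \<turnstile> G"

lemma int_theorem_id: "int_theorem (F \<^bold>\<rightarrow> F)"
  using MP[OF MP[OF S K] K] .

lemma ded_mono: "T \<turnstile> F \<Longrightarrow> T \<subseteq> U \<Longrightarrow> U \<turnstile> F"
  by (induction rule: ded.induct) (blast intro: ded.intros)+

lemma deduction: "insert F T \<turnstile> G \<Longrightarrow> T \<turnstile> F \<^bold>\<rightarrow> G"
proof (induction rule: ded.induct)
  case (taut G)
  then show ?case by (intro ded.taut MP[OF K])
next
  case (assm G)
  then consider "G = F" | "G \<in> T" by auto
  then show ?case
  proof cases
    case 2
    then show ?thesis by (intro ded.mp[OF ded.taut[OF K] ded.assm])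
  qed (simp add: ded.taut int_theorem_id)
next
  case (mp G H)
  then show ?case by (blast intro: ded.mp ded.taut S)
qed

lemma deduction_iff: "T \<turnstile> F \<^bold>\<rightarrow> G \<longleftrightarrow> insert F T \<turnstile> G"
  by (meson deduction ded.assm ded.mp ded_mono insertI1 subset_insertI)

lemma cut: "T \<turnstile> F \<Longrightarrow> insert F T \<turnstile> G \<Longrightarrow> T \<turnstile> G"
  using deduction ded.mp by blast

lemma ded_And: "T \<turnstile> F \<^bold>\<and> G \<longleftrightarrow> T \<turnstile> F \<and> T \<turnstile> G"
  by (meson AndE1 AndE2 AndI ded.mp ded.taut)

lemma ded_OrI1: "T \<turnstile> F \<Longrightarrow> T \<turnstile> F \<^bold>\<or> G"
  by (rule ded.mp[OF ded.taut[OF OrI1]])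

lemma ded_OrI2: "T \<turnstile> G \<Longrightarrow> T \<turnstile> F \<^bold>\<or> G"
  by (rule ded.mp[OF ded.taut[OF OrI2]])

lemma ded_OrE: "insert F T \<turnstile> H \<Longrightarrow> insert G T \<turnstile> H \<Longrightarrow> insert (F \<^bold>\<or> G) T \<turnstile> H"
  by (meson OrE deduction deduction_iff ded.mp ded.taut)

lemma ded_BotE: "T \<turnstile> \<^bold>\<bottom> \<Longrightarrow> T \<turnstile> F"
  by (rule ded.mp[OF ded.taut[OF BotE]])

lemma ded_not_notI: "T \<turnstile> F \<Longrightarrow> T \<turnstile> \<^bold>\<not> \<^bold>\<not> F"
  by (meson deduction ded.assm ded.mp ded_mono insertI1 subset_insertI)

text \<open>While a negation is being proved, a doubly negated formula may be used as if it were
  proved itself: from \<open>G\<close>, \<open>\<not> F\<close> follows by contraposition, which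
  contradicts \<open>\<not> \<not> F\<close>.\<close>

lemma ded_not_bind:
  assumes "T \<turnstile> \<^bold>\<not> \<^bold>\<not> F" "insert F T \<turnstile> \<^bold>\<not> G"
  shows "T \<turnstile> \<^bold>\<not> G"
proof (rule deduction)
  have "insert G T \<turnstile> \<^bold>\<not> F"
    using assms(2) by (simp add: deduction_iff insert_commute)
  moreover have "insert G T \<turnstile> \<^bold>\<not> \<^bold>\<not> F"
    using assms(1) by (rule ded_mono) auto
  ultimately show "insert G T \<turnstile> \<^bold>\<bottom>" by (rule ded.mp[rotated])
qed

lemma int_theorem_iff_ded: "int_theorem F \<longleftrightarrow> {} \<turnstile> F"
proof
  assume "{} \<turnstile> F"
  then show "int_theorem F" by (induction rule: ded.induct) (simp, simp, rule MP)
qed (rule ded.taut)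

lemma ded_conj: "T \<turnstile> conj Fs \<longleftrightarrow> (\<forall>F\<in>set Fs. T \<turnstile> F)"
  by (induction Fs rule: conj.induct) (auto simp: ded_And intro: ded.taut int_theorem_id)

lemma derives_iff_ded: "T \<turnstile>\<^sub>I F \<longleftrightarrow> T \<turnstile> F"
proof
  assume "T \<turnstile>\<^sub>I F"
  then obtain Fs where "set Fs \<subseteq> T" "int_theorem (conj Fs \<^bold>\<rightarrow> F)"
    by (auto simp: derives_def)
  moreover from this have "T \<turnstile> conj Fs"
    by (auto simp: ded_conj intro: ded.assm)
  ultimately show "T \<turnstile> F" using ded.mp[OF ded.taut] by blast
next
  \<comment> \<open>Needed for modus ponens, where the premise lists of both derivations are
    appended: \<open>conj\<close> of the appended list must yield \<open>conj\<close> of each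
    part.\<close>
  have conj_weaken: "{conj Gs} \<turnstile> conj Fs" if "set Fs \<subseteq> set Gs" for Fs Gs :: "'a form list"
  proof -
    have "{conj Gs} \<turnstile> conj Gs" by (simp add: ded.assm)
    then show ?thesis using that unfolding ded_conj by blast
  qed
  assume "T \<turnstile> F"
  then show "T \<turnstile>\<^sub>I F"
  proof (induction rule: ded.induct)
    case (taut F)
    then have "int_theorem (conj [] \<^bold>\<rightarrow> F)" by (rule MP[OF K])
    then show ?case unfolding derives_def by (intro exI[of _ "[]"]) simp
  next
    case (assm F)
    then show ?case unfolding derives_def
      by (intro exI[of _ "[F]"]) (simp add: int_theorem_id)
  next
    case (mp F G)
    then obtain Fs Gs where *: "set Fs \<subseteq> T" "int_theorem (conj Fs \<^bold>\<rightarrow> F \<^bold>\<rightarrow> G)"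
      "set Gs \<subseteq> T" "int_theorem (conj Gs \<^bold>\<rightarrow> F)"
      unfolding derives_def by blast
    have "{conj (Fs @ Gs)} \<turnstile> conj Fs" "{conj (Fs @ Gs)} \<turnstile> conj Gs"
      by (auto intro: conj_weaken)
    then have "{conj (Fs @ Gs)} \<turnstile> G"
      using ded.mp[OF ded.mp[OF ded.taut[OF *(2)]] ded.mp[OF ded.taut[OF *(4)]]] by blast
    then have "int_theorem (conj (Fs @ Gs) \<^bold>\<rightarrow> G)"
      by (simp add: int_theorem_iff_ded deduction_iff)
    then show ?case unfolding derives_def using * by (intro exI[of _ "Fs @ Gs"]) auto
  qed
qed

subsection \<open>Here-and-there models\<close>

text \<open>Truth at the lower world \<open>Y\<close> of a Kripke model whose upper world is
  \<open>X\<close>. An implication is tested at both worlds; \<open>ht X X\<close> is classical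
  truth in \<open>X\<close>.\<close>

fun ht :: "'a set \<Rightarrow> 'a set \<Rightarrow> 'a form \<Rightarrow> bool" where
  "ht Y X (Atom a) \<longleftrightarrow> a \<in> Y"
| "ht Y X \<^bold>\<bottom> \<longleftrightarrow> False"
| "ht Y X (F \<^bold>\<and> G) \<longleftrightarrow> ht Y X F \<and> ht Y X G"
| "ht Y X (F \<^bold>\<or> G) \<longleftrightarrow> ht Y X F \<or> ht Y X G"
| "ht Y X (H \<^bold>\<leftarrow> B) \<longleftrightarrow> (ht X X B \<longrightarrow> ht X X H) \<and> (ht Y X B \<longrightarrow> ht Y X H)"

lemma ht_persistent: "ht Y X F \<Longrightarrow> Y \<subseteq> X \<Longrightarrow> ht X X F"
  by (induction F) auto

lemma ht_int_theorem: "int_theorem F \<Longrightarrow> Y \<subseteq> X \<Longrightarrow> ht Y X F"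
  by (induction arbitrary: Y rule: int_theorem.induct) (auto dest: ht_persistent)

lemma ht_ded:
  assumes "T \<turnstile> F" "Y \<subseteq> X" "\<And>G. G \<in> T \<Longrightarrow> ht Y X G"
  shows "ht Y X F"
  using assms(1) by induction (use assms ht_int_theorem in auto)

lemma ht_restrict: "atoms F \<subseteq> A \<Longrightarrow> ht (Y \<inter> A) X F \<longleftrightarrow> ht Y X F"
  by (induction F) auto

text \<open>The reduct evaluates negations in \<open>X\<close>, and so does here-and-there logic: by
  persistence, a formula false at \<open>X\<close> is false at \<open>Y\<close> too.\<close>

lemma sat_reduct_iff_ht: "nested_formula F \<Longrightarrow> Y \<subseteq> X \<Longrightarrow> Y \<Turnstile> reduct X F \<longleftrightarrow> ht Y X F"
proof (induction arbitrary: Y rule: nested_formula.induct)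
  case (6 F)
  then show ?case using ht_persistent[of Y X F] by auto
qed simp_all

text \<open>Closedness of \<open>Y\<close> captures the lower half of the truth of a clause at
  \<open>(Y, X)\<close>; the upper half is the instance \<open>Y = X\<close>.\<close>

lemma closed_under_reduct_iff:
  assumes "augmented_program P" "Y \<subseteq> X"
  shows "closed_under Y (reduct_program P X) \<longleftrightarrow>
    (\<forall>H B. (H \<^bold>\<leftarrow> B) \<in> P \<longrightarrow> ht Y X B \<longrightarrow> ht Y X H)"
proof -
  have "nested_formula H \<and> nested_formula B" if "(H \<^bold>\<leftarrow> B) \<in> P" for H B
    using assms(1) that by (auto simp: augmented_program_def)
  then show ?thesis
    using assms(2)
    unfolding closed_under_def reduct_program_def mem_Collect_eq form.inject
    by (metis sat_reduct_iff_ht)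
qed

lemma atoms_clause:
  assumes "(H \<^bold>\<leftarrow> B) \<in> P"
  shows "atoms H \<subseteq> sig P" "atoms B \<subseteq> sig P"
  using UN_upper[OF assms, of atoms] by (auto simp: sig_def)

text \<open>Intersecting with \<open>sig P\<close> does not change the truth of clauses, so
  minimality excludes foreign atoms. This makes \<open>M\<close> finite in the main proof.\<close>

lemma answer_set_subset_sig:
  assumes "augmented_program P" "answer_set M P"
  shows "M \<subseteq> sig P"
proof -
  have "closed_under (M \<inter> sig P) (reduct_program P M)"
    using assms
    by (auto simp: answer_set_def basic_answer_set_def closed_under_reduct_iff
          ht_restrict atoms_clause)
  then show ?thesis
    using assms(2) unfolding answer_set_def basic_answer_set_def by blast
qed

subsection \<open>The theory of an answer set candidate\<close>

text \<open>An intuitionistic version of the classical fact that literals decide every formula: what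
  is true in \<open>M\<close> is proved under a double negation, what is false is refuted.\<close>

lemma ded_classical:
  assumes "\<And>a. a \<in> atoms F \<Longrightarrow> a \<in> M \<Longrightarrow> T \<turnstile> \<^bold>\<not> \<^bold>\<not> Atom a"
    and "\<And>a. a \<in> atoms F \<Longrightarrow> a \<notin> M \<Longrightarrow> T \<turnstile> \<^bold>\<not> Atom a"
  shows "if ht M M F then T \<turnstile> \<^bold>\<not> \<^bold>\<not> F else T \<turnstile> \<^bold>\<not> F"
  using assms
proof (induction F)
  case (Atom a)
  then show ?case by simp
next
  case Bot
  then show ?case by (simp add: ded.taut int_theorem_id)
next
  case (And F G)
  have "T \<turnstile> \<^bold>\<not> (F \<^bold>\<and> G)" if "T \<turnstile> \<^bold>\<not> F \<or> T \<turnstile> \<^bold>\<not> G"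
  proof (rule deduction)
    have "insert (F \<^bold>\<and> G) T \<turnstile> F" "insert (F \<^bold>\<and> G) T \<turnstile> G"
      using ded.assm[of "F \<^bold>\<and> G" "insert (F \<^bold>\<and> G) T"] by (simp_all add: ded_And)
    moreover have "insert (F \<^bold>\<and> G) T \<turnstile> \<^bold>\<not> F \<or> insert (F \<^bold>\<and> G) T \<turnstile> \<^bold>\<not> G"
      using that ded_mono[OF _ subset_insertI] by blast
    ultimately show "insert (F \<^bold>\<and> G) T \<turnstile> \<^bold>\<bottom>" using ded.mp by metis
  qed
  moreover have "T \<turnstile> \<^bold>\<not> \<^bold>\<not> (F \<^bold>\<and> G)" if *: "T \<turnstile> \<^bold>\<not> \<^bold>\<not> F" "T \<turnstile> \<^bold>\<not> \<^bold>\<not> G"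
  \<comment> \<open>The goal is a negation, so both double negations can be opened, first that of
    \<open>F\<close>, then that of \<open>G\<close>.\<close>
  proof (rule ded_not_bind[OF *(1) ded_not_bind[OF ded_mono[OF *(2)] ded_not_notI]])
    show "insert G (insert F T) \<turnstile> F \<^bold>\<and> G" by (simp add: ded_And ded.assm)
  qed auto
  moreover have "if ht M M F then T \<turnstile> \<^bold>\<not> \<^bold>\<not> F else T \<turnstile> \<^bold>\<not> F"
    "if ht M M G then T \<turnstile> \<^bold>\<not> \<^bold>\<not> G else T \<turnstile> \<^bold>\<not> G"
    using And.prems by (intro And.IH; simp)+
  ultimately show ?case by (auto split: if_splits)
next
  case (Or F G)
  have "T \<turnstile> \<^bold>\<not> (F \<^bold>\<or> G)" if "T \<turnstile> \<^bold>\<not> F" "T \<turnstile> \<^bold>\<not> G"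
    using that by (simp add: deduction_iff ded_OrE)
  moreover have "T \<turnstile> \<^bold>\<not> \<^bold>\<not> (F \<^bold>\<or> G)" if "T \<turnstile> \<^bold>\<not> \<^bold>\<not> F \<or> T \<turnstile> \<^bold>\<not> \<^bold>\<not> G"
    using that
    by (metis ded_not_bind ded_not_notI ded_OrI1 ded_OrI2 ded.assm insertI1)
  moreover have "if ht M M F then T \<turnstile> \<^bold>\<not> \<^bold>\<not> F else T \<turnstile> \<^bold>\<not> F"
    "if ht M M G then T \<turnstile> \<^bold>\<not> \<^bold>\<not> G else T \<turnstile> \<^bold>\<not> G"
    using Or.prems by (intro Or.IH; simp)+
  ultimately show ?case by (auto split: if_splits)
next
  case (Impl H B)
  have "T \<turnstile> \<^bold>\<not> \<^bold>\<not> (H \<^bold>\<leftarrow> B)" if "T \<turnstile> \<^bold>\<not> B"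
    using that by (intro ded_not_notI) (simp add: deduction_iff ded_BotE)
  moreover have "T \<turnstile> \<^bold>\<not> \<^bold>\<not> (H \<^bold>\<leftarrow> B)" if "T \<turnstile> \<^bold>\<not> \<^bold>\<not> H"
    using that by (rule ded_not_bind) (simp add: ded_not_notI deduction ded.assm)
  moreover have "T \<turnstile> \<^bold>\<not> (H \<^bold>\<leftarrow> B)" if *: "T \<turnstile> \<^bold>\<not> H" "T \<turnstile> \<^bold>\<not> \<^bold>\<not> B"
  proof (rule ded_not_bind[OF *(2) deduction])
    let ?U = "insert (H \<^bold>\<leftarrow> B) (insert B T)"
    have "?U \<turnstile> H" by (rule ded.mp[OF ded.assm ded.assm]) auto
    moreover have "?U \<turnstile> \<^bold>\<not> H" using *(1) by (rule ded_mono) auto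
    ultimately show "?U \<turnstile> \<^bold>\<bottom>" by (rule ded.mp[rotated])
  qed
  moreover have "if ht M M H then T \<turnstile> \<^bold>\<not> \<^bold>\<not> H else T \<turnstile> \<^bold>\<not> H"
    "if ht M M B then T \<turnstile> \<^bold>\<not> \<^bold>\<not> B else T \<turnstile> \<^bold>\<not> B"
    using Impl.prems by (intro Impl.IH; simp)+
  ultimately show ?case by (auto split: if_splits)
qed

text \<open>
  The second conclusion is stated with an arbitrary formula \<open>G\<close> so that it passes through
  disjunctions.
\<close>

lemma ded_nested:
  assumes "nested_formula F" "Y \<subseteq> M" "Atom ` Y \<subseteq> T"
    and "\<And>a. a \<in> atoms F \<Longrightarrow> a \<in> M \<Longrightarrow> T \<turnstile> \<^bold>\<not> \<^bold>\<not> Atom a"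
    and "\<And>a. a \<in> atoms F \<Longrightarrow> a \<notin> M \<Longrightarrow> T \<turnstile> \<^bold>\<not> Atom a"
    and "\<And>a. a \<in> M - Y \<Longrightarrow> insert (Atom a) T \<turnstile> G"
  shows "if ht Y M F then T \<turnstile> F else insert F T \<turnstile> G"
  using assms
proof (induction rule: nested_formula.induct)
  case (1 a)
  \<comment> \<open>The three cases: the atom is an assumption, it yields \<open>G\<close> by
    hypothesis, or it is refuted by \<open>T\<close>.\<close>
  then consider "a \<in> Y" | "a \<in> M - Y" | "a \<notin> M" by blast
  then show ?case
  proof cases
    case 3
    then have "insert (Atom a) T \<turnstile> \<^bold>\<bottom>" using 1 by (simp flip: deduction_iff)
    then show ?thesis using 1 3 by (auto intro: ded_BotE)
  qed (use 1 in \<open>auto intro: ded.assm\<close>)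
next
  case 2
  then show ?case by (simp add: ded.assm ded_BotE)
next
  case 3
  then show ?case by (auto intro: ded.taut int_theorem_id)
next
  case (4 F H)
  have IH: "if ht Y M F then T \<turnstile> F else insert F T \<turnstile> G"
    "if ht Y M H then T \<turnstile> H else insert H T \<turnstile> G"
    using "4.prems" by (intro "4.IH"; simp)+
  have "insert (F \<^bold>\<and> H) T \<turnstile> G" if "insert F T \<turnstile> G \<or> insert H T \<turnstile> G"
  proof -
    have "insert (F \<^bold>\<and> H) T \<turnstile> F" "insert (F \<^bold>\<and> H) T \<turnstile> H"
      using ded.assm[of "F \<^bold>\<and> H" "insert (F \<^bold>\<and> H) T"] by (simp_all add: ded_And)
    moreover have "T \<turnstile> F \<^bold>\<rightarrow> G \<or> T \<turnstile> H \<^bold>\<rightarrow> G" using that by (simp add: deduction_iff)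
    ultimately show ?thesis using ded.mp ded_mono[OF _ subset_insertI] by metis
  qed
  then show ?case using IH by (auto simp: ded_And split: if_splits)
next
  case (5 F H)
  have "if ht Y M F then T \<turnstile> F else insert F T \<turnstile> G"
    "if ht Y M H then T \<turnstile> H else insert H T \<turnstile> G"
    using "5.prems" by (intro "5.IH"; simp)+
  then show ?case by (auto intro: ded_OrI1 ded_OrI2 ded_OrE split: if_splits)
next
  case (6 F)
  \<comment> \<open>A negation depends on \<open>M\<close> alone, where \<open>F\<close> is decided
    up to double negation; hence \<open>T\<close> proves the negation of \<open>F\<close> or refutes
    it.\<close>
  have *: "if ht M M F then T \<turnstile> \<^bold>\<not> \<^bold>\<not> F else T \<turnstile> \<^bold>\<not> F"
    using "6.prems" by (intro ded_classical) simp_all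
  show ?case
  proof (cases "ht M M F")
    case True
    then have "insert (\<^bold>\<not> F) T \<turnstile> \<^bold>\<bottom>" using * by (simp add: deduction_iff)
    then show ?thesis using True by (simp add: ded_BotE)
  next
    case False
    then show ?thesis using * \<open>Y \<subseteq> M\<close> ht_persistent by auto
  qed
qed

text \<open>The assumed atoms \<open>Y\<close> are there for the induction, in which they grow
  towards \<open>M\<close>; the main proof uses \<open>Y = {}\<close>.\<close>

lemma ded_answer_set_atom:
  assumes "augmented_program P" "answer_set M P" "P \<subseteq> T"
    and "\<And>a. a \<in> sig P \<Longrightarrow> a \<in> M \<Longrightarrow> T \<turnstile> \<^bold>\<not> \<^bold>\<not> Atom a"
    and "\<And>a. a \<in> sig P \<Longrightarrow> a \<notin> M \<Longrightarrow> T \<turnstile> \<^bold>\<not> Atom a"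
    and "finite M" "Y \<subseteq> M" "a \<in> M"
  shows "T \<union> Atom ` Y \<turnstile> Atom a"
  using assms(7)
proof (induction "card (M - Y)" arbitrary: Y rule: less_induct)
  case (less Y)
  let ?T = "T \<union> Atom ` Y"
  show ?case
  proof (cases "Y = M")
    case True
    then show ?thesis using \<open>a \<in> M\<close> by (auto intro: ded.assm)
  next
    case False
    \<comment> \<open>By minimality of \<open>M\<close>, a proper subset is not closed, which
      supplies the failing clause.\<close>
    then have "\<not> closed_under Y (reduct_program P M)"
      using less.prems assms(2) by (auto simp: answer_set_def basic_answer_set_def)
    then obtain H B where HB: "(H \<^bold>\<leftarrow> B) \<in> P" "ht Y M B" "\<not> ht Y M H"
      using less.prems assms(1) by (auto simp: closed_under_reduct_iff)
    then have nested: "nested_formula H" "nested_formula B"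
      using assms(1) by (auto simp: augmented_program_def)
    have atoms: "atoms H \<subseteq> sig P" "atoms B \<subseteq> sig P"
      using atoms_clause[OF HB(1)] by auto
    have literals: "b \<in> sig P \<Longrightarrow> b \<in> M \<Longrightarrow> ?T \<turnstile> \<^bold>\<not> \<^bold>\<not> Atom b"
      "b \<in> sig P \<Longrightarrow> b \<notin> M \<Longrightarrow> ?T \<turnstile> \<^bold>\<not> Atom b" for b
      using assms(4,5) ded_mono[OF _ Un_upper1] by blast+
    have add_atom: "insert (Atom b) ?T \<turnstile> Atom a" if "b \<in> M - Y" for b
    proof -
      have "M - insert b Y \<subset> M - Y" using that by auto
      then have "card (M - insert b Y) < card (M - Y)"
        using \<open>finite M\<close> by (intro psubset_card_mono) auto
      then show ?thesis using less.hyps[of "insert b Y"] less.prems that by auto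
    qed
    \<comment> \<open>Taking \<open>Atom a\<close> as the arbitrary formula of
      \<open>ded_nested\<close> serves both sides of the clause: the body, true at
      \<open>(Y, M)\<close>, is proved, while the head, false there, yields
      \<open>Atom a\<close>.\<close>
    have decided: "if ht Y M F then ?T \<turnstile> F else insert F ?T \<turnstile> Atom a"
      if "nested_formula F" "atoms F \<subseteq> sig P" for F
      using that(1) less.prems
      by (rule ded_nested) (use that(2) literals add_atom in blast)+
    have "?T \<turnstile> B"
      using decided[OF nested(2) atoms(2)] HB(2) by simp
    moreover have "?T \<turnstile> H \<^bold>\<leftarrow> B" using HB(1) \<open>P \<subseteq> T\<close> by (auto intro: ded.assm)
    ultimately have "?T \<turnstile> H" by (rule ded.mp[rotated])
    moreover have "insert H ?T \<turnstile> Atom a"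
      using decided[OF nested(1) atoms(1)] HB(3) by simp
    ultimately show ?thesis by (rule cut)
  qed
qed

theorem theorem4p2:
  fixes P :: "'a form set" and M :: "'a set"
  assumes "augmented_program P"
  shows "answer_set M P \<longleftrightarrow>
    P \<union> {\<^bold>\<not> Atom a |a. a \<in> sig P - M} \<union> {\<^bold>\<not> \<^bold>\<not> Atom a |a. a \<in> M} \<turnstile>\<^sup>c\<^sub>I Atom ` M"
proof -
  define T where
    "T = P \<union> {\<^bold>\<not> Atom a |a. a \<in> sig P - M} \<union> {\<^bold>\<not> \<^bold>\<not> Atom a |a. a \<in> M}"
  have P_T: "P \<subseteq> T" by (auto simp: T_def)
  have literals: "a \<in> sig P \<Longrightarrow> a \<in> M \<Longrightarrow> T \<turnstile> \<^bold>\<not> \<^bold>\<not> Atom a"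
    "a \<in> sig P \<Longrightarrow> a \<notin> M \<Longrightarrow> T \<turnstile> \<^bold>\<not> Atom a" for a
    by (auto simp: T_def intro: ded.assm)
  have clause: "\<exists>H B. C = (H \<^bold>\<leftarrow> B)" if "C \<in> P" for C
    using assms that by (auto simp: augmented_program_def)
  \<comment> \<open>For a clause, the two closedness assumptions give the two worlds. The added
    literals are negations, hence settled by \<open>M\<close>.\<close>
  have ht_T: "ht Y M C"
    if "Y \<subseteq> M" "closed_under Y (reduct_program P M)" "closed_under M (reduct_program P M)" "C \<in> T"
    for Y C
  proof (cases "C \<in> P")
    case True
    then obtain H B where "C = (H \<^bold>\<leftarrow> B)" using clause by blast
    then show ?thesis using that True assms by (auto simp: closed_under_reduct_iff)
  next
    case False
    then show ?thesis using that by (auto simp: T_def)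
  qed
  have "answer_set M P \<longleftrightarrow> T \<turnstile>\<^sup>c\<^sub>I Atom ` M"
  proof
    assume M: "answer_set M P"
    then have "ht M M C" if "C \<in> T" for C
      using that ht_T[of M] by (auto simp: answer_set_def basic_answer_set_def)
    then have "\<not> T \<turnstile> \<^bold>\<bottom>" using ht_ded[of T "\<^bold>\<bottom>" M M] by auto
    moreover have "finite (sig P)"
      using assms by (auto simp: sig_def augmented_program_def)
    then have "finite M"
      using answer_set_subset_sig[OF assms M] by (rule rev_finite_subset)
    then have "T \<turnstile> Atom a" if "a \<in> M" for a
      using ded_answer_set_atom[OF assms M P_T literals, of "{}" a] that by simp
    ultimately show "T \<turnstile>\<^sup>c\<^sub>I Atom ` M"
      by (auto simp: derives_consistently_def consistent_def derives_iff_ded)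
  next
    assume "T \<turnstile>\<^sup>c\<^sub>I Atom ` M"
    then have cons: "\<not> T \<turnstile> \<^bold>\<bottom>" and M: "\<And>a. a \<in> M \<Longrightarrow> T \<turnstile> Atom a"
      by (auto simp: derives_consistently_def consistent_def derives_iff_ded)
    \<comment> \<open>A clause of \<open>P\<close> false in \<open>M\<close> would be refuted by
      \<open>T\<close> although \<open>T\<close> contains it, against consistency.\<close>
    have "ht M M C" if "C \<in> P" for C
    proof (rule ccontr)
      assume "\<not> ht M M C"
      moreover have "if ht M M C then T \<turnstile> \<^bold>\<not> \<^bold>\<not> C else T \<turnstile> \<^bold>\<not> C"
        using that by (intro ded_classical literals) (auto simp: sig_def)
      moreover have "T \<turnstile> C" using that P_T by (auto intro: ded.assm)
      ultimately show False using cons by (auto dest: ded.mp)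
    qed
    then have closed: "closed_under M (reduct_program P M)"
      using assms by (fastforce simp: closed_under_reduct_iff)
    moreover have "Y = M" if "Y \<subseteq> M" "closed_under Y (reduct_program P M)" for Y
    proof -
      \<comment> \<open>Soundness: \<open>(Y, M)\<close> is a model of \<open>T\<close>, so every
        atom that \<open>T\<close> proves lies in \<open>Y\<close>.\<close>
      have "ht Y M (Atom a)" if "a \<in> M" for a
        using M[OF that] \<open>Y \<subseteq> M\<close> ht_T[OF \<open>Y \<subseteq> M\<close> \<open>closed_under Y _\<close> closed] by (rule ht_ded)
      then show ?thesis using \<open>Y \<subseteq> M\<close> by auto
    qed
    ultimately show "answer_set M P"
      by (auto simp: answer_set_def basic_answer_set_def)
  qed
  then show ?thesis by (simp only: T_def)
qed

end
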